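(* Let $\mathbf{g}\in\mathbb{R}^{N_m}$ be the data vector, let $\mathbf{K}:W\to\mathbb{R}^{N_m}$ be the bounded linear discrete-data integral operator with Riesz representers $\eta_1,\dots,\eta_{N_m}\in W$, and let $f^\dagger\in W$ be the minimal-norm solution of $\mathbf{K}f=\mathbf{g}$, $f(a)=f(b)=0$ (all as defined in the context). Then there exist real coefficients $c_1,\dots,c_{N_m}$ such that $$f^\dagger=\sum_{\ell=1}^m\sum_{i=1}^{n_\ell} c_{i+N_{\ell-1}}\,\eta_{\ell,i},\qquad\text{where } \eta_{\ell,i}:=\eta_{i+N_{\ell-1}}.$$
   Context: Let $a<b$ be real. $W$ is the real Hilbert space $W=\{f\in L^2([a,b]) : f(a)=f(b)=0,\ f,f'\in AC([a,b]),\ f''\in L^2([a,b])\}$, where $AC([a,b])$ denotes the absolutely continuous functions on $[a,b]$, with inner product $\langle f,g\rangle_W=\int_a^b f''(x)g''(x)\,dx$ and norm $\|f\|_W=\|f''\|_{L^2}$. Let $m\ge1$, $n_1,\dots,n_m\ge 1$, $N_0=0$ and $N_r=\sum_{k=1}^r n_k$. For $\ell=1,\dots,m$ let $k_\ell:[c_\ell,d_\ell]\times[a,b]\to\mathbb{R}$ be a kernel, let $x_{\ell,1},\dots,x_{\ell,n_\ell}\in[c_\ell,d_\ell]$ be given points, and put $(K_\ell f)(x)=\int_a^b k_\ell(x,t)f(t)\,dt$. The operator $\mathbf{K}:W\to\mathbb{R}^{N_m}$ is defined by $(\mathbf{K}f)_j=(K_\ell f)(x_{\ell,i})$ for $j=i+N_{\ell-1}$,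 $\ell=1,\dots,m$, $i=1,\dots,n_\ell$. It is a standing assumption that $\mathbf{K}$ is a well-defined bounded linear operator on $W$. The data vector is $\mathbf{g}\in\mathbb{R}^{N_m}$ with components $\mathbf{g}_{i+N_{\ell-1}}=g_\ell(x_{\ell,i})$, where the $g_\ell:[c_\ell,d_\ell]\to\mathbb{R}$ are given. Riesz representers: $\eta_1,\dots,\eta_{N_m}\in W$ are the unique functions with $(\mathbf{K}f)_j=\langle\eta_j,f\rangle_W$ for all $f\in W$, $j=1,\dots,N_m$. Minimal-norm solution: $f^\dagger$ is the unique element of smallest norm $\|\cdot\|_W$ among all minimizers over $f\in W$ of $\|\mathbf{K}f-\mathbf{g}\|_2^2$, where $\|\cdot\|_2$ is the Euclidean norm (the problem $\mathbf{K}f=\mathbf{g}$ is understood in this least-squares sense). *)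

theory Defs
  imports "HOL-Analysis.Analysis"
begin

section \<open>The Hilbert space \<open>W\<close>\<close>

text \<open>
  A function on \<open>[a,b]\<close> is represented by a function \<open>real \<Rightarrow> real\<close>; all notions below depend only on
  its values on \<open>{a..b}\<close>, and equality of elements of \<open>W\<close> means equality on \<open>{a..b}\<close>.
\<close>

definition absolutely_continuous_on :: "real \<Rightarrow> real \<Rightarrow> (real \<Rightarrow> real) \<Rightarrow> bool" where
  "absolutely_continuous_on a b f \<longleftrightarrow>
     (\<forall>\<epsilon>>0. \<exists>\<delta>>0. \<forall>(p::nat) u v.
        (\<forall>i<p. a \<le> u i \<and> u i \<le> v i \<and> v i \<le> b) \<and>
        disjoint_family_on (\<lambda>i. {u i<..<v i}) {..<p} \<and>
        (\<Sum>i<p. v i - u i) < \<delta>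
        \<longrightarrow> (\<Sum>i<p. \<bar>f (v i) - f (u i)\<bar>) < \<epsilon>)"

definition L2_on :: "real \<Rightarrow> real \<Rightarrow> (real \<Rightarrow> real) \<Rightarrow> bool" where
  "L2_on a b f \<longleftrightarrow> f \<in> borel_measurable (lebesgue_on {a..b}) \<and>
     integrable (lebesgue_on {a..b}) (\<lambda>x. (f x)\<^sup>2)"

text \<open>Derivatives are one-sided at the end points. Where the derivative does not exist the value is
  unspecified; for second derivatives of elements of \<open>W\<close> this concerns a null set only.\<close>

definition deriv_on :: "real \<Rightarrow> real \<Rightarrow> (real \<Rightarrow> real) \<Rightarrow> real \<Rightarrow> real" where
  "deriv_on a b f x = vector_derivative f (at x within {a..b})"

definition deriv2_on :: "real \<Rightarrow> real \<Rightarrow> (real \<Rightarrow> real) \<Rightarrow> real \<Rightarrow> real" where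
  "deriv2_on a b f = deriv_on a b (deriv_on a b f)"

text \<open>The condition that \<open>f''\<close> belongs to \<open>L\<^sup>2\<close> is split into the existence of \<open>f''\<close> almost everywhere
  (which absolute continuity of \<open>f'\<close> entails) and its square integrability.\<close>

definition W :: "real \<Rightarrow> real \<Rightarrow> (real \<Rightarrow> real) set" where
  "W a b = {f. L2_on a b f \<and> f a = 0 \<and> f b = 0 \<and>
     absolutely_continuous_on a b f \<and>
     (\<forall>x\<in>{a..b}. f differentiable (at x within {a..b})) \<and>
     absolutely_continuous_on a b (deriv_on a b f) \<and>
     (AE x in lebesgue_on {a..b}. deriv_on a b f differentiable (at x within {a..b})) \<and>
     L2_on a b (deriv2_on a b f)}"

definition W_inner :: "real \<Rightarrow> real \<Rightarrow> (real \<Rightarrow> real) \<Rightarrow> (real \<Rightarrow> real) \<Rightarrow> real" where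
  "W_inner a b f h = (LINT x|lebesgue_on {a..b}. deriv2_on a b f x * deriv2_on a b h x)"

definition W_norm :: "real \<Rightarrow> real \<Rightarrow> (real \<Rightarrow> real) \<Rightarrow> real" where
  "W_norm a b f = sqrt (LINT x|lebesgue_on {a..b}. (deriv2_on a b f x)\<^sup>2)"

section \<open>Stacked vectors and the discrete-data operator\<close>

text \<open>
  A vector in \<open>\<real>\<^sup>N\<close> is a function \<open>nat \<Rightarrow> real\<close> of which only the values on \<open>{1..N}\<close> matter. A flat index
  \<open>j \<in> {1..N\<^sub>m}\<close> is written uniquely as \<open>j = i + N\<^bsub>l-1\<^esub>\<close> with \<open>l \<in> {1..m}\<close> and \<open>i \<in> {1..n\<^sub>l}\<close>;
  \<open>block n j\<close> is this \<open>l\<close> and \<open>pos n j\<close> is this \<open>i\<close>.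
\<close>

definition offset :: "(nat \<Rightarrow> nat) \<Rightarrow> nat \<Rightarrow> nat" where
  "offset n r = (\<Sum>l=1..r. n l)"

definition block :: "(nat \<Rightarrow> nat) \<Rightarrow> nat \<Rightarrow> nat" where
  "block n j = (LEAST l. j \<le> offset n l)"

definition pos :: "(nat \<Rightarrow> nat) \<Rightarrow> nat \<Rightarrow> nat" where
  "pos n j = j - offset n (block n j - 1)"

definition integral_op :: "real \<Rightarrow> real \<Rightarrow> (real \<Rightarrow> real \<Rightarrow> real) \<Rightarrow> (real \<Rightarrow> real) \<Rightarrow> real \<Rightarrow> real" where
  "integral_op a b \<kappa> f x = (LINT t|lebesgue_on {a..b}. \<kappa> x t * f t)"

definition discrete_op ::
  "real \<Rightarrow> real \<Rightarrow> (nat \<Rightarrow> nat) \<Rightarrow> (nat \<Rightarrow> real \<Rightarrow> real \<Rightarrow> real) \<Rightarrow> (nat \<Rightarrow> nat \<Rightarrow> real) \<Rightarrow>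
   (real \<Rightarrow> real) \<Rightarrow> nat \<Rightarrow> real" where
  "discrete_op a b n k x f j =
     integral_op a b (k (block n j)) f (x (block n j) (pos n j))"

definition data_vector ::
  "(nat \<Rightarrow> nat) \<Rightarrow> (nat \<Rightarrow> nat \<Rightarrow> real) \<Rightarrow> (nat \<Rightarrow> real \<Rightarrow> real) \<Rightarrow> nat \<Rightarrow> real" where
  "data_vector n x g j = g (block n j) (x (block n j) (pos n j))"

lemma block_offset:
  assumes "1 \<le> l" "1 \<le> i" "i \<le> n l"
  shows "block n (i + offset n (l - 1)) = l"
  unfolding block_def
proof (rule Least_equality)
  obtain q where l: "l = Suc q" using assms(1) by (cases l) auto
  show "i + offset n (l - 1) \<le> offset n l" using assms(3) by (simp add: l offset_def)
  fix y assume y: "i + offset n (l - 1) \<le> offset n y"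
  show "l \<le> y"
  proof (rule ccontr)
    assume "\<not> l \<le> y"
    then have "offset n y \<le> offset n (l - 1)"
      unfolding offset_def by (intro sum_mono2) auto
    with y assms(2) show False by simp
  qed
qed

lemma pos_offset:
  assumes "1 \<le> l" "1 \<le> i" "i \<le> n l"
  shows "pos n (i + offset n (l - 1)) = i"
  using block_offset[of l i n, OF assms] by (simp add: pos_def)

lemma discrete_op_offset:
  assumes "1 \<le> l" "1 \<le> i" "i \<le> n l"
  shows "discrete_op a b n k x f (i + offset n (l - 1)) = integral_op a b (k l) f (x l i)"
  by (simp only: discrete_op_def block_offset[of l i n, OF assms] pos_offset[of l i n, OF assms])

lemma data_vector_offset:
  assumes "1 \<le> l" "1 \<le> i" "i \<le> n l"
  shows "data_vector n x g (i + offset n (l - 1)) = g l (x l i)"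
  by (simp only: data_vector_def block_offset[of l i n, OF assms] pos_offset[of l i n, OF assms])

definition bounded_linear_on_W ::
  "real \<Rightarrow> real \<Rightarrow> nat \<Rightarrow> ((real \<Rightarrow> real) \<Rightarrow> nat \<Rightarrow> real) \<Rightarrow> bool" where
  "bounded_linear_on_W a b N T \<longleftrightarrow>
     (\<forall>f\<in>W a b. \<forall>h\<in>W a b. \<forall>j\<in>{1..N}. T (\<lambda>t. f t + h t) j = T f j + T h j) \<and>
     (\<forall>f\<in>W a b. \<forall>s. \<forall>j\<in>{1..N}. T (\<lambda>t. s * f t) j = s * T f j) \<and>
     (\<exists>C. \<forall>f\<in>W a b. L2_set (T f) {1..N} \<le> C * W_norm a b f)"

definition is_Riesz_representer ::
  "real \<Rightarrow> real \<Rightarrow> ((real \<Rightarrow> real) \<Rightarrow> real) \<Rightarrow> (real \<Rightarrow> real) \<Rightarrow> bool" where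
  "is_Riesz_representer a b \<phi> \<eta> \<longleftrightarrow> \<eta> \<in> W a b \<and> (\<forall>f\<in>W a b. \<phi> f = W_inner a b \<eta> f)"

section \<open>Minimal-norm least-squares solutions\<close>

definition is_least_squares_solution ::
  "real \<Rightarrow> real \<Rightarrow> nat \<Rightarrow> ((real \<Rightarrow> real) \<Rightarrow> nat \<Rightarrow> real) \<Rightarrow> (nat \<Rightarrow> real) \<Rightarrow> (real \<Rightarrow> real) \<Rightarrow> bool" where
  "is_least_squares_solution a b N T y =
     is_arg_min (\<lambda>f. (L2_set (\<lambda>j. T f j - y j) {1..N})\<^sup>2) (\<lambda>f. f \<in> W a b)"

definition is_minimal_norm_solution ::
  "real \<Rightarrow> real \<Rightarrow> nat \<Rightarrow> ((real \<Rightarrow> real) \<Rightarrow> nat \<Rightarrow> real) \<Rightarrow> (nat \<Rightarrow> real) \<Rightarrow> (real \<Rightarrow> real) \<Rightarrow> bool" where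
  "is_minimal_norm_solution a b N T y =
     is_arg_min (W_norm a b) (is_least_squares_solution a b N T y)"

end

theory Submission
  imports Defs
begin

text \<open>
  Write the minimal-norm solution as \<open>p + h\<close> with \<open>p\<close> in the span of the representers and \<open>h\<close>
  orthogonal to it. Then \<open>h\<close> is annihilated by the operator, so \<open>p\<close> is also a least-squares solution,
  and by Pythagoras minimality forces \<open>h\<close> to have norm zero, that is \<open>h'' = 0\<close> almost everywhere.
  Since \<open>h'\<close> is absolutely continuous it is constant, and the boundary conditions give \<open>h = 0\<close>.
\<close>

subsection \<open>Absolutely continuous functions with vanishing derivative\<close>

text \<open>Passing from \<open>h'' = 0\<close> almost everywhere to constant \<open>h'\<close> is
  the analytic obstacle: the increments of \<open>h'\<close> over the exceptional null set have to
  be controlled, and the Cantor function shows that continuity alone would not do this. A second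
  difficulty is one of representation. Elements of \<open>W\<close> are functions on the whole line
  whose second derivatives exist only almost everywhere, so \<open>deriv2_on\<close> is linear only
  off a null set, and \<open>W_inner\<close> vanishes on nonzero functions that live outside the
  interval. Since the representers may also be linearly dependent, the projection onto their span
  must tolerate residuals of norm zero and cannot simply normalize.\<close>

lemma absolutely_continuous_on_cong:
  assumes "\<And>t. t \<in> {a..b} \<Longrightarrow> f t = h t"
  shows "absolutely_continuous_on a b f \<longleftrightarrow> absolutely_continuous_on a b h"
proof -
  have "absolutely_continuous_on a b h" if f: "absolutely_continuous_on a b f"
    and eq: "\<And>t. t \<in> {a..b} \<Longrightarrow> f t = h t" for f h
    unfolding absolutely_continuous_on_def
  proof (intro allI impI)
    fix e :: real assume "e > 0"
    with f obtain d where d: "d > 0" "\<And>(p::nat) u v.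
        (\<forall>i<p. a \<le> u i \<and> u i \<le> v i \<and> v i \<le> b) \<Longrightarrow>
        disjoint_family_on (\<lambda>i. {u i<..<v i}) {..<p} \<Longrightarrow>
        (\<Sum>i<p. v i - u i) < d \<Longrightarrow> (\<Sum>i<p. \<bar>f (v i) - f (u i)\<bar>) < e"
      unfolding absolutely_continuous_on_def by meson
    show "\<exists>d>0. \<forall>(p::nat) u v. (\<forall>i<p. a \<le> u i \<and> u i \<le> v i \<and> v i \<le> b) \<and>
        disjoint_family_on (\<lambda>i. {u i<..<v i}) {..<p} \<and> (\<Sum>i<p. v i - u i) < d
        \<longrightarrow> (\<Sum>i<p. \<bar>h (v i) - h (u i)\<bar>) < e"
    proof (intro exI[of _ d] conjI allI impI)
      show "d > 0" by fact
      fix p :: nat and u v :: "nat \<Rightarrow> real"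
      assume *: "(\<forall>i<p. a \<le> u i \<and> u i \<le> v i \<and> v i \<le> b) \<and>
        disjoint_family_on (\<lambda>i. {u i<..<v i}) {..<p} \<and> (\<Sum>i<p. v i - u i) < d"
      have "(\<Sum>i<p. \<bar>h (v i) - h (u i)\<bar>) = (\<Sum>i<p. \<bar>f (v i) - f (u i)\<bar>)"
      proof (rule sum.cong)
        fix i assume "i \<in> {..<p}"
        with * have "a \<le> u i" "u i \<le> v i" "v i \<le> b" by auto
        then have "f (v i) = h (v i)" "f (u i) = h (u i)" by (auto intro!: eq)
        then show "\<bar>h (v i) - h (u i)\<bar> = \<bar>f (v i) - f (u i)\<bar>" by simp
      qed simp
      also have "\<dots> < e" using * by (intro d(2)) auto
      finally show "(\<Sum>i<p. \<bar>h (v i) - h (u i)\<bar>) < e" .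
    qed
  qed
  from this[of f h] this[of h f] assms show ?thesis by auto
qed

lemma absolutely_continuous_on_const: "absolutely_continuous_on a b (\<lambda>t. z)"
  unfolding absolutely_continuous_on_def by (auto intro!: exI[of _ 1])

lemma absolutely_continuous_on_lincomb:
  assumes f: "absolutely_continuous_on a b f" and h: "absolutely_continuous_on a b h"
  shows "absolutely_continuous_on a b (\<lambda>t. f t + s * h t)"
  unfolding absolutely_continuous_on_def
proof (intro allI impI)
  fix e :: real assume e: "e > 0"
  \<comment> \<open>The factor \<open>\<bar>s\<bar> + 1\<close> in place of
    \<open>\<bar>s\<bar>\<close> keeps the tolerance for \<open>h\<close> well defined and positive
    when \<open>s = 0\<close>.\<close>
  then have "e/2 > 0" "e / (2 * (\<bar>s\<bar> + 1)) > 0" by (auto intro!: divide_pos_pos)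
  obtain d1 where d1: "d1 > 0" "\<And>(p::nat) u v.
      (\<forall>i<p. a \<le> u i \<and> u i \<le> v i \<and> v i \<le> b) \<Longrightarrow>
      disjoint_family_on (\<lambda>i. {u i<..<v i}) {..<p} \<Longrightarrow>
      (\<Sum>i<p. v i - u i) < d1 \<Longrightarrow> (\<Sum>i<p. \<bar>f (v i) - f (u i)\<bar>) < e/2"
    using f \<open>e/2 > 0\<close> unfolding absolutely_continuous_on_def by meson
  obtain d2 where d2: "d2 > 0" "\<And>(p::nat) u v.
      (\<forall>i<p. a \<le> u i \<and> u i \<le> v i \<and> v i \<le> b) \<Longrightarrow>
      disjoint_family_on (\<lambda>i. {u i<..<v i}) {..<p} \<Longrightarrow>
      (\<Sum>i<p. v i - u i) < d2 \<Longrightarrow> (\<Sum>i<p. \<bar>h (v i) - h (u i)\<bar>) < e / (2 * (\<bar>s\<bar> + 1))"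
    using h \<open>e / (2 * (\<bar>s\<bar> + 1)) > 0\<close> unfolding absolutely_continuous_on_def by meson
  show "\<exists>d>0. \<forall>(p::nat) u v. (\<forall>i<p. a \<le> u i \<and> u i \<le> v i \<and> v i \<le> b) \<and>
      disjoint_family_on (\<lambda>i. {u i<..<v i}) {..<p} \<and> (\<Sum>i<p. v i - u i) < d
      \<longrightarrow> (\<Sum>i<p. \<bar>(f (v i) + s * h (v i)) - (f (u i) + s * h (u i))\<bar>) < e"
  proof (intro exI[of _ "min d1 d2"] conjI allI impI)
    show "min d1 d2 > 0" using d1 d2 by simp
    fix p :: nat and u v :: "nat \<Rightarrow> real"
    assume *: "(\<forall>i<p. a \<le> u i \<and> u i \<le> v i \<and> v i \<le> b) \<and>
      disjoint_family_on (\<lambda>i. {u i<..<v i}) {..<p} \<and> (\<Sum>i<p. v i - u i) < min d1 d2"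
    have 1: "(\<Sum>i<p. \<bar>f (v i) - f (u i)\<bar>) < e/2" using * by (intro d1(2)) auto
    have 2: "(\<Sum>i<p. \<bar>h (v i) - h (u i)\<bar>) < e / (2 * (\<bar>s\<bar> + 1))" using * by (intro d2(2)) auto
    have "(\<Sum>i<p. \<bar>(f (v i) + s * h (v i)) - (f (u i) + s * h (u i))\<bar>)
        \<le> (\<Sum>i<p. \<bar>f (v i) - f (u i)\<bar> + (\<bar>s\<bar> + 1) * \<bar>h (v i) - h (u i)\<bar>)"
    proof (rule sum_mono)
      fix i
      have "\<bar>(f (v i) + s * h (v i)) - (f (u i) + s * h (u i))\<bar>
          = \<bar>(f (v i) - f (u i)) + s * (h (v i) - h (u i))\<bar>" by (simp add: algebra_simps)
      also have "\<dots> \<le> \<bar>f (v i) - f (u i)\<bar> + \<bar>s\<bar> * \<bar>h (v i) - h (u i)\<bar>"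
        by (metis abs_mult abs_triangle_ineq)
      also have "\<dots> \<le> \<bar>f (v i) - f (u i)\<bar> + (\<bar>s\<bar> + 1) * \<bar>h (v i) - h (u i)\<bar>"
        by (simp add: algebra_simps)
      finally show "\<bar>(f (v i) + s * h (v i)) - (f (u i) + s * h (u i))\<bar>
        \<le> \<bar>f (v i) - f (u i)\<bar> + (\<bar>s\<bar> + 1) * \<bar>h (v i) - h (u i)\<bar>" .
    qed
    also have "\<dots> = (\<Sum>i<p. \<bar>f (v i) - f (u i)\<bar>) + (\<bar>s\<bar> + 1) * (\<Sum>i<p. \<bar>h (v i) - h (u i)\<bar>)"
      by (simp add: sum.distrib sum_distrib_left)
    also have "\<dots> < e/2 + (\<bar>s\<bar> + 1) * (e / (2 * (\<bar>s\<bar> + 1)))"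
      using 1 2 by (intro add_strict_mono mult_strict_left_mono) auto
    also have "\<dots> = e" by (simp add: field_simps)
    finally show "(\<Sum>i<p. \<bar>(f (v i) + s * h (v i)) - (f (u i) + s * h (u i))\<bar>) < e" .
  qed
qed

text \<open>The definition indexes intervals by natural numbers, whereas a tagged division is a
  finite set of pairs of a tag and a cell. A bijection with an initial segment of the naturals
  bridges the two.\<close>

lemma absolutely_continuous_on_finite_index:
  assumes f: "absolutely_continuous_on a b f" and "e > 0"
  obtains d where "d > 0"
    "\<And>(I :: 'i set) u v. finite I \<Longrightarrow> (\<And>i. i \<in> I \<Longrightarrow> a \<le> u i \<and> u i \<le> v i \<and> v i \<le> b) \<Longrightarrow>
      disjoint_family_on (\<lambda>i. {u i<..<v i}) I \<Longrightarrow>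
      (\<Sum>i\<in>I. v i - u i) < d \<Longrightarrow> (\<Sum>i\<in>I. \<bar>f (v i) - f (u i)\<bar>) < e"
proof -
  obtain d where d: "d > 0" "\<And>(p::nat) u v.
      (\<forall>i<p. a \<le> u i \<and> u i \<le> v i \<and> v i \<le> b) \<Longrightarrow>
      disjoint_family_on (\<lambda>i. {u i<..<v i}) {..<p} \<Longrightarrow>
      (\<Sum>i<p. v i - u i) < d \<Longrightarrow> (\<Sum>i<p. \<bar>f (v i) - f (u i)\<bar>) < e"
    using assms unfolding absolutely_continuous_on_def by meson
  show ?thesis
  proof (rule that[OF d(1)])
    fix I :: "'i set" and u v
    assume fin: "finite I" and uv: "\<And>i. i \<in> I \<Longrightarrow> a \<le> u i \<and> u i \<le> v i \<and> v i \<le> b"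
      and disj: "disjoint_family_on (\<lambda>i. {u i<..<v i}) I" and len: "(\<Sum>i\<in>I. v i - u i) < d"
    obtain \<pi> where \<pi>: "bij_betw \<pi> {..<card I} I"
      using ex_bij_betw_nat_finite[OF fin] by (auto simp: atLeast0LessThan)
    note reindex = sum.reindex_bij_betw[OF \<pi>]
    have "(\<Sum>i<card I. \<bar>f ((v \<circ> \<pi>) i) - f ((u \<circ> \<pi>) i)\<bar>) < e"
    proof (rule d(2))
      show "\<forall>i<card I. a \<le> (u \<circ> \<pi>) i \<and> (u \<circ> \<pi>) i \<le> (v \<circ> \<pi>) i \<and> (v \<circ> \<pi>) i \<le> b"
        using uv bij_betwE[OF \<pi>] by auto
      show "disjoint_family_on (\<lambda>i. {(u \<circ> \<pi>) i<..<(v \<circ> \<pi>) i}) {..<card I}"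
        unfolding disjoint_family_on_def
      proof (intro ballI impI)
        fix i j assume ij: "i \<in> {..<card I}" "j \<in> {..<card I}" "i \<noteq> j"
        then have "\<pi> i \<noteq> \<pi> j" "\<pi> i \<in> I" "\<pi> j \<in> I"
          using \<pi> by (auto simp: bij_betw_def inj_on_def)
        then show "{(u \<circ> \<pi>) i<..<(v \<circ> \<pi>) i} \<inter> {(u \<circ> \<pi>) j<..<(v \<circ> \<pi>) j} = {}"
          using disj unfolding disjoint_family_on_def comp_def by blast
      qed
      show "(\<Sum>i<card I. (v \<circ> \<pi>) i - (u \<circ> \<pi>) i) < d"
        using len reindex[of "\<lambda>i. v i - u i"] by simp
    qed
    then show "(\<Sum>i\<in>I. \<bar>f (v i) - f (u i)\<bar>) < e"
      using reindex[of "\<lambda>i. \<bar>f (v i) - f (u i)\<bar>"] by simp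
  qed
qed

text \<open>Choose a gauge that is fine for the vanishing derivative at tags off \<open>Z\<close> and that keeps the
  cells tagged in \<open>Z\<close> inside a small open neighbourhood of \<open>Z\<close>, where absolute continuity applies; by
  Cousin's lemma the interval has a tagged division subordinate to it.\<close>

lemma absolutely_continuous_zero_derivative_endpoints:
  assumes ab: "a \<le> b" and ac: "absolutely_continuous_on a b f"
    and Z: "Z \<in> null_sets lebesgue"
    and der: "\<And>t. t \<in> {a..b} - Z \<Longrightarrow> (f has_vector_derivative 0) (at t within {a..b})"
  shows "f a = f b"
proof -
  have "\<bar>f b - f a\<bar> \<le> e * (b - a + 1)" if e: "e > 0" for e
  proof -
    obtain d where d: "d > 0"
      "\<And>(I :: (real \<times> real set) set) u v. finite I \<Longrightarrow>
        (\<And>i. i \<in> I \<Longrightarrow> a \<le> u i \<and> u i \<le> v i \<and> v i \<le> b) \<Longrightarrow>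
        disjoint_family_on (\<lambda>i. {u i<..<v i}) I \<Longrightarrow>
        (\<Sum>i\<in>I. v i - u i) < d \<Longrightarrow> (\<Sum>i\<in>I. \<bar>f (v i) - f (u i)\<bar>) < e"
      using absolutely_continuous_on_finite_index[OF ac e] by blast
    have Zs: "Z \<in> sets lebesgue" using Z by auto
    obtain U where U: "open U" "Z \<subseteq> U" "U - Z \<in> lmeasurable" "emeasure lebesgue (U - Z) < ennreal d"
      using sets_lebesgue_outer_open[OF Zs d(1)] by blast
    have Us: "U \<in> sets lebesgue" using U(1) by simp
    \<comment> \<open>As \<open>Z\<close> is null, removing it does not change the measure of
      \<open>U\<close>.\<close>
    have Um: "emeasure lebesgue U < ennreal d"
      using U(4) emeasure_Diff_null_set[OF Z Us] by simp
    have "\<exists>r>0. (t \<in> Z \<longrightarrow> ball t r \<subseteq> U) \<and>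
        (t \<in> {a..b} - Z \<longrightarrow> (\<forall>y\<in>{a..b}. \<bar>y - t\<bar> < r \<longrightarrow> \<bar>f y - f t\<bar> \<le> e * \<bar>y - t\<bar>))" for t
    proof (cases "t \<in> Z")
      case True
      then have "t \<in> U" using U(2) by auto
      then show ?thesis using U(1) True by (auto simp: open_contains_ball)
    next
      case nZ: False
      show ?thesis
      proof (cases "t \<in> {a..b}")
        case True
        then have "(f has_derivative (\<lambda>h. 0)) (at t within {a..b})"
          using der[of t] nZ by (simp add: has_vector_derivative_def)
        then obtain r where "r > 0" "\<And>y. y \<in> {a..b} \<Longrightarrow> norm (y - t) < r \<Longrightarrow>
            norm (f y - f t - 0) \<le> e * norm (y - t)"
          using e unfolding has_derivative_within_alt by blast
        then show ?thesis using nZ by (intro exI[of _ r]) auto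
      next
        case False
        \<comment> \<open>A gauge assigns a radius to every real, but points outside the interval
          are subject to no condition here, so any radius serves.\<close>
        then show ?thesis using nZ by (intro exI[of _ 1]) auto
      qed
    qed
    then obtain r where r: "\<And>t. r t > 0" "\<And>t. t \<in> Z \<Longrightarrow> ball t (r t) \<subseteq> U"
      "\<And>t y. t \<in> {a..b} - Z \<Longrightarrow> y \<in> {a..b} \<Longrightarrow> \<bar>y - t\<bar> < r t \<Longrightarrow> \<bar>f y - f t\<bar> \<le> e * \<bar>y - t\<bar>"
      by metis
    have "gauge (\<lambda>t. ball t (r t))" using r(1) by (simp add: gauge_ball_dependent)
    then obtain p where p: "p tagged_division_of {a..b}" "(\<lambda>t. ball t (r t)) fine p"
      by (rule fine_division_exists_real)
    define u v where "u = (\<lambda>i :: real \<times> real set. Inf (snd i))" and "v = (\<lambda>i :: real \<times> real set. Sup (snd i))"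
    note pD = tagged_division_ofD[OF p(1)]
    have fin: "finite p" by (rule pD(1))
    have K: "snd i = {u i..v i} \<and> fst i \<in> {u i..v i} \<and> a \<le> u i \<and> u i \<le> v i \<and> v i \<le> b
        \<and> {u i..v i} \<subseteq> ball (fst i) (r (fst i))" if ip: "i \<in> p" for i
    proof -
      obtain t K where i: "i = (t, K)" by (cases i)
      obtain l w where lw: "K = {l..w}" using pD(4)[of t K] ip i by auto
      have t: "t \<in> {l..w}" using pD(2)[of t K] ip i lw by auto
      have sub: "{l..w} \<subseteq> {a..b}" using pD(3)[of t K] ip i lw by auto
      have "{l..w} \<subseteq> ball t (r t)" using p(2) ip i lw by (auto simp: fine_def)
      moreover have "u i = l" "v i = w" using i lw t by (auto simp: u_def v_def)
      ultimately show ?thesis using i lw t sub by auto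
    qed
    have disj: "disjoint_family_on (\<lambda>i. {u i<..<v i}) p"
      unfolding disjoint_family_on_def
    proof (intro ballI impI)
      fix i j assume ij: "i \<in> p" "j \<in> p" "i \<noteq> j"
      have "interior (snd i) \<inter> interior (snd j) = {}"
        using pD(5)[of "fst i" "snd i" "fst j" "snd j"] ij by (auto simp: prod_eq_iff)
      then show "{u i<..<v i} \<inter> {u j<..<v j} = {}"
        using K[OF ij(1)] K[OF ij(2)] by simp
    qed
    \<comment> \<open>The cells tagged in \<open>Z\<close> are handled by absolute continuity, the
      remaining ones by the derivative estimate.\<close>
    define A where "A = {i\<in>p. fst i \<in> Z}"
    have A: "A \<subseteq> p" "finite A" using fin by (auto simp: A_def)
    have disjA: "disjoint_family_on (\<lambda>i. {u i<..<v i}) A"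
      by (rule disjoint_family_on_mono[OF A(1) disj])
    have lenA: "(\<Sum>i\<in>A. v i - u i) < d"
    proof -
      have nn: "0 \<le> v i - u i" if "i \<in> A" for i using K[of i] A(1) that by auto
      \<comment> \<open>The cells in \<open>A\<close> have disjoint interiors contained in
        \<open>U\<close>, so their total length is at most the measure of \<open>U\<close>.\<close>
      have "ennreal (\<Sum>i\<in>A. v i - u i) = (\<Sum>i\<in>A. ennreal (v i - u i))"
        using nn by (simp add: sum_ennreal)
      also have "\<dots> = (\<Sum>i\<in>A. emeasure lebesgue {u i<..<v i})"
        using nn by (intro sum.cong) auto
      also have "\<dots> = emeasure lebesgue (\<Union>i\<in>A. {u i<..<v i})"
        using A(2) disjA by (intro sum_emeasure) auto
      also have "\<dots> \<le> emeasure lebesgue U"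
      proof (rule emeasure_mono[OF _ Us])
        show "(\<Union>i\<in>A. {u i<..<v i}) \<subseteq> U"
        proof (rule UN_least)
          fix i assume i: "i \<in> A"
          then have "{u i<..<v i} \<subseteq> {u i..v i}" "i \<in> p" "fst i \<in> Z" by (auto simp: A_def)
          then show "{u i<..<v i} \<subseteq> U" using K[of i] r(2)[of "fst i"] by blast
        qed
      qed
      also have "\<dots> < ennreal d" by (rule Um)
      finally show ?thesis using ennreal_leI[of d "\<Sum>i\<in>A. v i - u i"] by (meson not_le)
    qed
    have sumA: "(\<Sum>i\<in>A. \<bar>f (v i) - f (u i)\<bar>) < e"
    proof (rule d(2)[OF A(2) _ disjA lenA])
      show "a \<le> u i \<and> u i \<le> v i \<and> v i \<le> b" if "i \<in> A" for i
        using K[of i] A(1) that by auto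
    qed
    have len: "(\<Sum>i\<in>p. v i - u i) = b - a"
      using additive_tagged_division_1[OF ab p(1), of "\<lambda>t. t"]
      by (simp add: u_def v_def case_prod_unfold)
    have "(\<Sum>i\<in>p-A. \<bar>f (v i) - f (u i)\<bar>) \<le> (\<Sum>i\<in>p-A. e * (v i - u i))"
    proof (rule sum_mono)
      fix i assume i: "i \<in> p - A"
      note Ki = K[of i]
      have "u i \<in> {u i..v i}" "v i \<in> {u i..v i}" using Ki i by auto
      then have uv: "u i \<in> ball (fst i) (r (fst i))" "v i \<in> ball (fst i) (r (fst i))"
        using Ki i by blast+
      have t: "fst i \<in> {a..b} - Z" using Ki i by (auto simp: A_def)
      have "\<bar>f (u i) - f (fst i)\<bar> \<le> e * \<bar>u i - fst i\<bar>"
        using Ki i uv by (intro r(3)[OF t]) (auto simp: dist_real_def abs_minus_commute)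
      moreover have "\<bar>f (v i) - f (fst i)\<bar> \<le> e * \<bar>v i - fst i\<bar>"
        using Ki i uv by (intro r(3)[OF t]) (auto simp: dist_real_def abs_minus_commute)
      \<comment> \<open>The tag lies between the end points of its cell, so its distances to them
        add up to exactly the length of the cell.\<close>
      moreover have "\<bar>u i - fst i\<bar> = fst i - u i" "\<bar>v i - fst i\<bar> = v i - fst i" using Ki i by auto
      ultimately show "\<bar>f (v i) - f (u i)\<bar> \<le> e * (v i - u i)"
        by (simp add: algebra_simps)
    qed
    also have "\<dots> \<le> (\<Sum>i\<in>p. e * (v i - u i))"
      using fin K e by (intro sum_mono2) force+
    also have "\<dots> = e * (b - a)" by (simp add: len sum_distrib_left[symmetric])
    finally have sumB: "(\<Sum>i\<in>p-A. \<bar>f (v i) - f (u i)\<bar>) \<le> e * (b - a)" .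
    have "f b - f a = (\<Sum>i\<in>p. f (v i) - f (u i))"
      using additive_tagged_division_1[OF ab p(1), of f]
      by (simp add: u_def v_def case_prod_unfold)
    then have "\<bar>f b - f a\<bar> \<le> (\<Sum>i\<in>p. \<bar>f (v i) - f (u i)\<bar>)" by simp
    also have "\<dots> = (\<Sum>i\<in>p-A. \<bar>f (v i) - f (u i)\<bar>) + (\<Sum>i\<in>A. \<bar>f (v i) - f (u i)\<bar>)"
      by (rule sum.subset_diff[OF A(1) fin])
    also have "\<dots> \<le> e * (b - a + 1)" using sumA sumB by (simp add: algebra_simps)
    finally show ?thesis .
  qed
  note bound = this
  have "\<bar>f b - f a\<bar> \<le> 0 + e" if "e > 0" for e
  proof -
    \<comment> \<open>The summand 1 is the contribution of the cells tagged in \<open>Z\<close>; it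
      also keeps the divisor positive in the degenerate case \<open>a = b\<close>.\<close>
    have "e / (b - a + 1) > 0" using that ab by simp
    from bound[OF this] show ?thesis using ab by simp
  qed
  then have "\<bar>f b - f a\<bar> \<le> 0" by (rule field_le_epsilon)
  then show ?thesis by simp
qed

lemma absolutely_continuous_on_subinterval:
  assumes f: "absolutely_continuous_on a b f" and "a \<le> a'" "b' \<le> b"
  shows "absolutely_continuous_on a' b' f"
  unfolding absolutely_continuous_on_def
proof (intro allI impI)
  fix e :: real assume "e > 0"
  with f obtain d where d: "d > 0" "\<And>(p::nat) u v.
      (\<forall>i<p. a \<le> u i \<and> u i \<le> v i \<and> v i \<le> b) \<Longrightarrow>
      disjoint_family_on (\<lambda>i. {u i<..<v i}) {..<p} \<Longrightarrow>
      (\<Sum>i<p. v i - u i) < d \<Longrightarrow> (\<Sum>i<p. \<bar>f (v i) - f (u i)\<bar>) < e"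
    unfolding absolutely_continuous_on_def by meson
  show "\<exists>d>0. \<forall>(p::nat) u v. (\<forall>i<p. a' \<le> u i \<and> u i \<le> v i \<and> v i \<le> b') \<and>
      disjoint_family_on (\<lambda>i. {u i<..<v i}) {..<p} \<and> (\<Sum>i<p. v i - u i) < d
      \<longrightarrow> (\<Sum>i<p. \<bar>f (v i) - f (u i)\<bar>) < e"
  proof (intro exI[of _ d] conjI allI impI)
    show "d > 0" by fact
    fix p :: nat and u v :: "nat \<Rightarrow> real"
    assume *: "(\<forall>i<p. a' \<le> u i \<and> u i \<le> v i \<and> v i \<le> b') \<and>
      disjoint_family_on (\<lambda>i. {u i<..<v i}) {..<p} \<and> (\<Sum>i<p. v i - u i) < d"
    have "\<forall>i<p. a \<le> u i \<and> u i \<le> v i \<and> v i \<le> b" using * assms(2,3) by force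
    with * show "(\<Sum>i<p. \<bar>f (v i) - f (u i)\<bar>) < e" by (intro d(2)) auto
  qed
qed

text \<open>The end point statement applied to each \<open>{a..t}\<close>: absolute continuity and
  the derivative condition both pass to subintervals.\<close>

lemma absolutely_continuous_zero_derivative_constant:
  assumes ac: "absolutely_continuous_on a b f"
    and ae: "AE t in lebesgue_on {a..b}. (f has_vector_derivative 0) (at t within {a..b})"
    and t: "t \<in> {a..b}"
  shows "f t = f a"
proof -
  have "AE t in lebesgue. t \<in> {a..b} \<longrightarrow> (f has_vector_derivative 0) (at t within {a..b})"
    using ae by (simp add: AE_restrict_space_iff)
  then obtain Z where Z: "Z \<in> null_sets lebesgue"
    "{t. \<not> (t \<in> {a..b} \<longrightarrow> (f has_vector_derivative 0) (at t within {a..b}))} \<subseteq> Z"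
    by (auto simp: eventually_ae_filter)
  have "f a = f t"
  proof (rule absolutely_continuous_zero_derivative_endpoints[where f = f, OF _ _ Z(1)])
    show "a \<le> t" using t by simp
    show "absolutely_continuous_on a t f"
      using t by (intro absolutely_continuous_on_subinterval[OF ac]) auto
    fix y assume "y \<in> {a..t} - Z"
    then have "(f has_vector_derivative 0) (at y within {a..b})" using Z(2) t by auto
    then show "(f has_vector_derivative 0) (at y within {a..t})"
      by (rule has_vector_derivative_within_subset) (use t in auto)
  qed
  then show ?thesis by simp
qed

subsection \<open>The space \<open>W\<close>\<close>

text \<open>Rests on completeness of Lebesgue measure, used after extending both functions by zero
  to the whole line.\<close>

lemma borel_measurable_lebesgue_on_AE:
  fixes f h :: "real \<Rightarrow> real"
  assumes f: "f \<in> borel_measurable (lebesgue_on S)" and S: "S \<in> sets lebesgue"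
    and ae: "AE t in lebesgue_on S. f t = h t"
  shows "h \<in> borel_measurable (lebesgue_on S)"
proof -
  have "(\<lambda>t. if t \<in> S then f t else 0) \<in> borel_measurable lebesgue"
    using f S by (simp add: borel_measurable_if)
  moreover have "AE t in lebesgue. (if t \<in> S then f t else 0) = (if t \<in> S then h t else 0)"
    using ae S by (auto simp: AE_restrict_space_iff)
  ultimately have "(\<lambda>t. if t \<in> S then h t else 0) \<in> borel_measurable lebesgue"
    by (rule borel_measurable_AE)
  then show ?thesis using S by (simp add: borel_measurable_if)
qed

text \<open>Domination by the sum of squares, from \<open>2 * \<bar>f t * h t\<bar> \<le> (f
  t)\<^sup>2 + (h t)\<^sup>2\<close>.\<close>

lemma L2_on_mult_integrable:
  assumes f: "L2_on a b f" and h: "L2_on a b h"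
  shows "integrable (lebesgue_on {a..b}) (\<lambda>t. f t * h t)"
proof (rule Bochner_Integration.integrable_bound)
  show "integrable (lebesgue_on {a..b}) (\<lambda>t. (f t)\<^sup>2 + (h t)\<^sup>2)"
    using f h by (simp add: L2_on_def)
  show "(\<lambda>t. f t * h t) \<in> borel_measurable (lebesgue_on {a..b})"
    using f h by (auto simp: L2_on_def)
  have "\<bar>f t * h t\<bar> \<le> \<bar>(f t)\<^sup>2 + (h t)\<^sup>2\<bar>" for t
  proof -
    have "2 * \<bar>f t * h t\<bar> \<le> (f t)\<^sup>2 + (h t)\<^sup>2"
      using sum_squares_bound[of "\<bar>f t\<bar>" "\<bar>h t\<bar>"] by (simp add: abs_mult mult.assoc)
    then show ?thesis by linarith
  qed
  then show "AE t in lebesgue_on {a..b}. norm (f t * h t) \<le> norm ((f t)\<^sup>2 + (h t)\<^sup>2)" by simp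
qed

lemma L2_on_lincomb:
  assumes f: "L2_on a b f" and h: "L2_on a b h"
  shows "L2_on a b (\<lambda>t. f t + s * h t)"
proof -
  have "integrable (lebesgue_on {a..b}) (\<lambda>t. (f t)\<^sup>2 + 2 * s * (f t * h t) + s\<^sup>2 * (h t)\<^sup>2)"
    using f h L2_on_mult_integrable[OF f h]
    by (intro Bochner_Integration.integrable_add integrable_mult_right) (auto simp: L2_on_def)
  moreover have "(\<lambda>t. (f t)\<^sup>2 + 2 * s * (f t * h t) + s\<^sup>2 * (h t)\<^sup>2) = (\<lambda>t. (f t + s * h t)\<^sup>2)"
    by (simp add: fun_eq_iff power2_eq_square algebra_simps)
  ultimately show ?thesis using f h by (auto simp: L2_on_def)
qed

lemma L2_on_AE_cong:
  assumes f: "L2_on a b f" and ae: "AE t in lebesgue_on {a..b}. f t = h t"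
  shows "L2_on a b h"
proof -
  have h: "h \<in> borel_measurable (lebesgue_on {a..b})"
    by (rule borel_measurable_lebesgue_on_AE[OF _ _ ae]) (use f in \<open>simp_all add: L2_on_def\<close>)
  have eq: "AE t in lebesgue_on {a..b}. (f t)\<^sup>2 = (h t)\<^sup>2" using ae by eventually_elim simp
  have "integrable (lebesgue_on {a..b}) (\<lambda>t. (f t)\<^sup>2)" using f by (simp add: L2_on_def)
  then have "integrable (lebesgue_on {a..b}) (\<lambda>t. (h t)\<^sup>2)"
    by (rule integrable_cong_AE_imp[OF _ borel_measurable_power[OF h] eq])
  with h show ?thesis by (simp add: L2_on_def)
qed

section \<open>First and second derivatives of linear combinations\<close>

lemma deriv_on_eqI:
  assumes "a < b" "t \<in> {a..b}" "(f has_vector_derivative z) (at t within {a..b})"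
  shows "deriv_on a b f t = z"
  unfolding deriv_on_def using vector_derivative_within_cbox[of a b t f z] assms by simp

lemma has_vector_derivative_deriv_on:
  assumes "f differentiable (at t within {a..b})"
  shows "(f has_vector_derivative deriv_on a b f t) (at t within {a..b})"
  using assms by (simp add: deriv_on_def vector_derivative_works)

lemma has_vector_derivative_lincomb:
  fixes f h :: "real \<Rightarrow> real"
  assumes "(f has_vector_derivative f') F" "(h has_vector_derivative h') F"
  shows "((\<lambda>t. f t + s * h t) has_vector_derivative f' + s * h') F"
  using assms by (intro has_vector_derivative_add has_vector_derivative_mult_right)

lemma deriv_on_lincomb:
  assumes "a < b" and f: "f \<in> W a b" and h: "h \<in> W a b" and t: "t \<in> {a..b}"
  shows "((\<lambda>t. f t + s * h t) has_vector_derivative deriv_on a b f t + s * deriv_on a b h t)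
      (at t within {a..b})"
    and "deriv_on a b (\<lambda>t. f t + s * h t) t = deriv_on a b f t + s * deriv_on a b h t"
proof -
  show *: "((\<lambda>t. f t + s * h t) has_vector_derivative deriv_on a b f t + s * deriv_on a b h t)
      (at t within {a..b})"
    using f h t by (intro has_vector_derivative_lincomb has_vector_derivative_deriv_on) (auto simp: W_def)
  show "deriv_on a b (\<lambda>t. f t + s * h t) t = deriv_on a b f t + s * deriv_on a b h t"
    by (rule deriv_on_eqI[OF assms(1) t *])
qed

text \<open>Only almost everywhere, because both second derivatives must exist at the point;
  elsewhere \<open>deriv2_on\<close> has unspecified values that need not add up. The form
  \<open>f t + s * h t\<close> covers sums, multiples and differences at once.\<close>

lemma deriv2_on_lincomb:
  assumes ab: "a < b" and f: "f \<in> W a b" and h: "h \<in> W a b"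
  shows "AE t in lebesgue_on {a..b}.
      (deriv_on a b (\<lambda>t. f t + s * h t) has_vector_derivative deriv2_on a b f t + s * deriv2_on a b h t)
        (at t within {a..b}) \<and>
      deriv2_on a b (\<lambda>t. f t + s * h t) t = deriv2_on a b f t + s * deriv2_on a b h t"
proof -
  have "AE t in lebesgue_on {a..b}. t \<in> {a..b}" by (rule AE_I2) simp
  moreover have "AE t in lebesgue_on {a..b}. deriv_on a b f differentiable (at t within {a..b})"
    "AE t in lebesgue_on {a..b}. deriv_on a b h differentiable (at t within {a..b})"
    using f h by (auto simp: W_def)
  ultimately show ?thesis
  proof eventually_elim
    case (elim t)
    have *: "(deriv_on a b (\<lambda>t. f t + s * h t) has_vector_derivative deriv2_on a b f t + s * deriv2_on a b h t)
        (at t within {a..b})"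
      unfolding deriv2_on_def
    proof (rule has_vector_derivative_transform[OF elim(1) deriv_on_lincomb(2)[OF ab f h]])
      show "((\<lambda>t. deriv_on a b f t + s * deriv_on a b h t) has_vector_derivative
          deriv_on a b (deriv_on a b f) t + s * deriv_on a b (deriv_on a b h) t) (at t within {a..b})"
        using elim by (intro has_vector_derivative_lincomb has_vector_derivative_deriv_on)
    qed
    moreover have "deriv2_on a b (\<lambda>t. f t + s * h t) t = deriv2_on a b f t + s * deriv2_on a b h t"
      using deriv_on_eqI[OF ab elim(1) *] by (simp add: deriv2_on_def)
    ultimately show ?case by blast
  qed
qed

lemma W_lincomb:
  assumes ab: "a < b" and f: "f \<in> W a b" and h: "h \<in> W a b"
  shows "(\<lambda>t. f t + s * h t) \<in> W a b"
proof -
  have "absolutely_continuous_on a b (\<lambda>t. deriv_on a b f t + s * deriv_on a b h t)"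
    using f h by (intro absolutely_continuous_on_lincomb) (auto simp: W_def)
  then have "absolutely_continuous_on a b (deriv_on a b (\<lambda>t. f t + s * h t))"
    by (subst absolutely_continuous_on_cong[where h = "\<lambda>t. deriv_on a b f t + s * deriv_on a b h t"])
      (auto intro: deriv_on_lincomb(2)[OF ab f h])
  moreover have "\<forall>t\<in>{a..b}. (\<lambda>t. f t + s * h t) differentiable (at t within {a..b})"
    using deriv_on_lincomb(1)[OF ab f h] by (blast intro: differentiableI_vector)
  moreover have "AE t in lebesgue_on {a..b}.
      deriv_on a b (\<lambda>t. f t + s * h t) differentiable (at t within {a..b})"
    using deriv2_on_lincomb[OF ab f h] by eventually_elim (blast intro: differentiableI_vector)
  moreover have "L2_on a b (deriv2_on a b (\<lambda>t. f t + s * h t))"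
  proof (rule L2_on_AE_cong)
    show "L2_on a b (\<lambda>t. deriv2_on a b f t + s * deriv2_on a b h t)"
      using f h by (intro L2_on_lincomb) (auto simp: W_def)
    show "AE t in lebesgue_on {a..b}. deriv2_on a b f t + s * deriv2_on a b h t =
        deriv2_on a b (\<lambda>t. f t + s * h t) t"
      using deriv2_on_lincomb[OF ab f h, of s] by eventually_elim simp
  qed
  moreover have "L2_on a b (\<lambda>t. f t + s * h t)" "absolutely_continuous_on a b (\<lambda>t. f t + s * h t)"
    using f h by (auto simp: W_def intro!: L2_on_lincomb absolutely_continuous_on_lincomb)
  ultimately show ?thesis using f h by (simp add: W_def)
qed

lemma W_zero:
  assumes ab: "a < b"
  shows "(\<lambda>t. 0) \<in> W a b"
proof -
  have d: "deriv_on a b (\<lambda>t. 0) t = 0" if "t \<in> {a..b}" for t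
    using that by (intro deriv_on_eqI[OF ab]) auto
  \<comment> \<open>\<open>deriv_on\<close> is unspecified outside the interval, so it is known to
    vanish only on \<open>{a..b}\<close>; this suffices for a derivative within that set.\<close>
  have d1: "(deriv_on a b (\<lambda>t. 0) has_vector_derivative 0) (at t within {a..b})" if "t \<in> {a..b}" for t
    by (rule has_vector_derivative_transform[OF that d]) auto
  have d2: "deriv2_on a b (\<lambda>t. 0) t = 0" if "t \<in> {a..b}" for t
    unfolding deriv2_on_def using that d1 by (intro deriv_on_eqI[OF ab])
  have L2: "L2_on a b (\<lambda>t. 0)" by (simp add: L2_on_def)
  have "L2_on a b (deriv2_on a b (\<lambda>t. 0))"
    by (rule L2_on_AE_cong[OF L2], rule AE_I2) (simp add: d2)
  moreover have "AE t in lebesgue_on {a..b}. deriv_on a b (\<lambda>t. 0) differentiable (at t within {a..b})"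
    by (rule AE_I2) (auto intro: differentiableI_vector[OF d1])
  moreover have "absolutely_continuous_on a b (deriv_on a b (\<lambda>t. 0))"
    by (subst absolutely_continuous_on_cong[where h = "\<lambda>t. 0"])
      (auto intro: d absolutely_continuous_on_const)
  ultimately show ?thesis using L2 absolutely_continuous_on_const by (simp add: W_def)
qed

lemma W_sum:
  fixes N :: nat
  assumes ab: "a < b" and "\<And>j. j \<in> {1..N} \<Longrightarrow> e j \<in> W a b"
  shows "(\<lambda>t. \<Sum>j=1..N. w j * e j t) \<in> W a b"
  using assms(2)
proof (induction N)
  case 0
  then show ?case using W_zero[OF ab] by simp
next
  case (Suc N)
  have "(\<lambda>t. (\<Sum>j=1..N. w j * e j t) + w (Suc N) * e (Suc N) t) \<in> W a b"
    using Suc by (intro W_lincomb[OF ab]) auto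
  then show ?case by simp
qed

section \<open>The bilinear form \<open>W_inner\<close> and its null vectors\<close>

lemma W_inner_commute: "W_inner a b f h = W_inner a b h f"
  by (simp add: W_inner_def mult.commute)

lemma W_inner_lincomb_left:
  assumes ab: "a < b" and f: "f \<in> W a b" and h: "h \<in> W a b" and q: "q \<in> W a b"
  shows "W_inner a b (\<lambda>t. f t + s * h t) q = W_inner a b f q + s * W_inner a b h q"
proof -
  let ?M = "lebesgue_on {a..b}" and ?D = "deriv2_on a b"
  have L: "L2_on a b (?D f)" "L2_on a b (?D h)" "L2_on a b (?D q)" using f h q by (auto simp: W_def)
  have L': "L2_on a b (?D (\<lambda>t. f t + s * h t))" using W_lincomb[OF ab f h] by (auto simp: W_def)
  have "W_inner a b (\<lambda>t. f t + s * h t) q = (LINT t|?M. ?D f t * ?D q t + s * (?D h t * ?D q t))"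
    unfolding W_inner_def
  proof (rule integral_cong_AE)
    show "AE t in ?M. ?D (\<lambda>t. f t + s * h t) t * ?D q t = ?D f t * ?D q t + s * (?D h t * ?D q t)"
      using deriv2_on_lincomb[OF ab f h, of s] by eventually_elim (simp add: algebra_simps)
  qed (use L L' in \<open>auto simp: L2_on_def\<close>)
  also have "\<dots> = W_inner a b f q + s * W_inner a b h q"
    using L2_on_mult_integrable[OF L(1) L(3)] L2_on_mult_integrable[OF L(2) L(3)]
    by (simp add: W_inner_def)
  finally show ?thesis .
qed

lemma W_inner_lincomb_right:
  assumes "a < b" "f \<in> W a b" "h \<in> W a b" "q \<in> W a b"
  shows "W_inner a b q (\<lambda>t. f t + s * h t) = W_inner a b q f + s * W_inner a b q h"
  using W_inner_lincomb_left[OF assms, of s] by (simp add: W_inner_commute[of a b q])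

lemma W_inner_self: "W_inner a b f f = (LINT t|lebesgue_on {a..b}. (deriv2_on a b f t)\<^sup>2)"
  by (simp add: W_inner_def power2_eq_square)

lemma W_inner_sum_right:
  fixes N :: nat
  assumes ab: "a < b" and f: "f \<in> W a b" and "\<And>j. j \<in> {1..N} \<Longrightarrow> e j \<in> W a b"
  shows "W_inner a b f (\<lambda>t. \<Sum>j=1..N. w j * e j t) = (\<Sum>j=1..N. w j * W_inner a b f (e j))"
  using assms(3)
proof (induction N)
  case 0
  \<comment> \<open>Writing zero as \<open>0 + 1 * 0\<close>, linearity says that this number is
    twice itself.\<close>
  have "W_inner a b f (\<lambda>t. 0) = 0"
    using W_inner_lincomb_right[OF ab W_zero[OF ab] W_zero[OF ab] f, of 1] by simp
  then show ?case by simp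
next
  case (Suc N)
  have "W_inner a b f (\<lambda>t. (\<Sum>j=1..N. w j * e j t) + w (Suc N) * e (Suc N) t)
      = W_inner a b f (\<lambda>t. \<Sum>j=1..N. w j * e j t) + w (Suc N) * W_inner a b f (e (Suc N))"
    using Suc by (intro W_inner_lincomb_right[OF ab _ _ f] W_sum[OF ab]) auto
  with Suc show ?case by simp
qed

lemma W_inner_self_eq_0_AE:
  assumes h: "h \<in> W a b" and 0: "W_inner a b h h = 0"
  shows "AE t in lebesgue_on {a..b}. deriv2_on a b h t = 0"
proof -
  have "integrable (lebesgue_on {a..b}) (\<lambda>t. (deriv2_on a b h t)\<^sup>2)"
    using h by (auto simp: W_def L2_on_def)
  then have "AE t in lebesgue_on {a..b}. (deriv2_on a b h t)\<^sup>2 = 0"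
    using 0 integral_nonneg_eq_0_iff_AE[of "lebesgue_on {a..b}" "\<lambda>t. (deriv2_on a b h t)\<^sup>2"]
    by (simp add: W_inner_self)
  then show ?thesis by simp
qed

lemma W_inner_self_eq_0_imp:
  assumes ab: "a < b" and h: "h \<in> W a b" and 0: "W_inner a b h h = 0" and t: "t \<in> {a..b}"
  shows "h t = 0"
proof -
  define z where "z = deriv_on a b h a"
  have "AE t in lebesgue_on {a..b}. deriv_on a b h differentiable (at t within {a..b})"
    using h by (simp add: W_def)
  with W_inner_self_eq_0_AE[OF h 0]
  have "AE t in lebesgue_on {a..b}. (deriv_on a b h has_vector_derivative 0) (at t within {a..b})"
  proof eventually_elim
    case (elim t)
    then show ?case using has_vector_derivative_deriv_on[OF elim(2)] by (simp add: deriv2_on_def)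
  qed
  then have z: "deriv_on a b h t = z" if "t \<in> {a..b}" for t
    using h that unfolding z_def
    by (intro absolutely_continuous_zero_derivative_constant) (auto simp: W_def)
  \<comment> \<open>Here \<open>h\<close> itself is differentiable everywhere with derivative
    \<open>z\<close>, so subtracting the line of slope \<open>z\<close> leaves a constant by the
    ordinary mean value argument.\<close>
  have "((\<lambda>t. h t + (-z) * t) has_derivative (\<lambda>h. 0)) (at t within {a..b})" if "t \<in> {a..b}" for t
  proof -
    have "h differentiable (at t within {a..b})" using h that by (simp add: W_def)
    then have "(h has_vector_derivative z) (at t within {a..b})"
      using has_vector_derivative_deriv_on[of h t a b] z[OF that] by simp
    then have "((\<lambda>t. h t + (-z) * t) has_vector_derivative z + (-z) * 1) (at t within {a..b})"
      by (intro has_vector_derivative_lincomb has_vector_derivative_id)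
    then show ?thesis by (simp add: has_vector_derivative_def)
  qed
  then obtain w where w: "\<And>t. t \<in> {a..b} \<Longrightarrow> h t + (-z) * t = w"
    using has_derivative_zero_constant[of "{a..b}" "\<lambda>t. h t + (-z) * t"] by auto
  have "h a = 0" "h b = 0" using h by (auto simp: W_def)
  moreover have "h a + (-z) * a = h b + (-z) * b" using w[of a] w[of b] ab by simp
  \<comment> \<open>An affine function that vanishes at two distinct points has slope zero.\<close>
  ultimately have "z * (b - a) = 0" by argo
  with ab have "z = 0" by simp
  with w[of a] w[OF t] \<open>h a = 0\<close> ab show ?thesis by simp
qed

text \<open>A vector of norm zero is orthogonal to everything, as its second derivative vanishes
  almost everywhere. This settles the degenerate case of the projection.\<close>

lemma W_inner_eq_0:
  assumes h: "h \<in> W a b" and 0: "W_inner a b h h = 0"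
  shows "W_inner a b f h = 0"
  unfolding W_inner_def
  using W_inner_self_eq_0_AE[OF assms] by (intro integral_eq_zero_AE) auto

text \<open>Gram--Schmidt step: the new vector is split as \<open>q + r\<close> with \<open>q\<close> in the old span and \<open>r\<close>
  orthogonal to it; if \<open>r\<close> has norm zero the old projection still works.\<close>

lemma W_projection_exists:
  fixes N :: nat
  assumes ab: "a < b" and "\<And>j. j \<in> {1..N} \<Longrightarrow> e j \<in> W a b" and "f \<in> W a b"
  shows "\<exists>w. \<forall>i\<in>{1..N}. W_inner a b (\<lambda>t. f t + (-1) * (\<Sum>j=1..N. w j * e j t)) (e i) = 0"
  using assms(2,3)
\<comment> \<open>\<open>f\<close> is generalized because the induction hypothesis is applied both
  to \<open>f\<close> and to the new vector \<open>e (Suc N)\<close>.\<close>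
proof (induction N arbitrary: f)
  case 0
  then show ?case by simp
next
  case (Suc N)
  let ?I = "W_inner a b"
  let ?S = "\<lambda>w t. \<Sum>j=1..N. w j * e j t"
  have e: "e j \<in> W a b" if "j \<in> {1..N}" for j using Suc.prems(1) that by simp
  have eN: "e (Suc N) \<in> W a b" using Suc.prems(1) by simp
  have S: "?S w \<in> W a b" for w using W_sum[OF ab e] .
  obtain w where w: "\<And>i. i \<in> {1..N} \<Longrightarrow> ?I (\<lambda>t. f t + (-1) * ?S w t) (e i) = 0"
    using Suc.IH[OF e Suc.prems(2)] by blast
  obtain w' where w': "\<And>i. i \<in> {1..N} \<Longrightarrow> ?I (\<lambda>t. e (Suc N) t + (-1) * ?S w' t) (e i) = 0"
    using Suc.IH[OF e eN] by blast
  define r where "r = (\<lambda>t. e (Suc N) t + (-1) * ?S w' t)"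
  define h where "h = (\<lambda>t. f t + (-1) * ?S w t)"
  have rW: "r \<in> W a b" unfolding r_def by (rule W_lincomb[OF ab eN S])
  have hW: "h \<in> W a b" unfolding h_def by (rule W_lincomb[OF ab Suc.prems(2) S])
  have orth: "?I h (?S w') = 0" "?I r (?S w') = 0"
    using w w' by (simp_all only: W_inner_sum_right[OF ab hW e] W_inner_sum_right[OF ab rW e])
      (simp_all add: h_def r_def)
  \<comment> \<open>Vectors orthogonal to the old projection \<open>?S w'\<close> pair with
    \<open>e (Suc N)\<close> exactly as they pair with \<open>r\<close>.\<close>
  have split: "?I q (e (Suc N)) = ?I q (?S w') + ?I q r" if "q \<in> W a b" for q
    using W_inner_lincomb_right[OF ab eN S that, of "-1" w'] by (simp add: r_def)
  \<comment> \<open>The coefficient that makes \<open>h - s * r\<close> orthogonal to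
    \<open>r\<close>. If \<open>r\<close> has norm zero, division by zero yields
    \<open>s = 0\<close> and the old coefficients are kept.\<close>
  define s where "s = ?I h r / ?I r r"
  \<comment> \<open>Obtained by expanding \<open>s * r\<close>, whose part in the old span is
    \<open>- s * ?S w'\<close>.\<close>
  define w'' where "w'' = (\<lambda>j. if j = Suc N then s else w j + (-s) * w' j)"
  have eq: "(\<lambda>t. f t + (-1) * (\<Sum>j=1..Suc N. w'' j * e j t)) = (\<lambda>t. h t + (-s) * r t)"
  proof
    fix t
    have "(\<Sum>j=1..N. w'' j * e j t) = (\<Sum>j=1..N. w j * e j t + (-s) * (w' j * e j t))"
      by (rule sum.cong) (auto simp: w''_def algebra_simps)
    also have "\<dots> = ?S w t + (-s) * ?S w' t"
      by (simp only: sum.distrib sum_distrib_left)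
    finally have "(\<Sum>j=1..Suc N. w'' j * e j t) = ?S w t + (-s) * ?S w' t + s * e (Suc N) t"
      by (simp add: w''_def)
    then show "f t + (-1) * (\<Sum>j=1..Suc N. w'' j * e j t) = h t + (-s) * r t"
      unfolding h_def r_def by (simp add: algebra_simps)
  qed
  have "?I (\<lambda>t. h t + (-s) * r t) (e i) = 0" if i: "i \<in> {1..Suc N}" for i
  proof (cases "i = Suc N")
    case False
    with i have "i \<in> {1..N}" by auto
    then show ?thesis
      using W_inner_lincomb_left[OF ab hW rW e, of i "-s"] w w' by (simp add: h_def r_def)
  next
    case True
    have "?I (\<lambda>t. h t + (-s) * r t) (e (Suc N)) = ?I h r + (-s) * ?I r r"
      using W_inner_lincomb_left[OF ab hW rW eN, of "-s"] split[OF hW] split[OF rW] orth by simp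
    also have "\<dots> = 0"
      \<comment> \<open>If \<open>?I r r = 0\<close>, then \<open>?I h r = 0\<close> as well;
        otherwise the quotient defining \<open>s\<close> cancels.\<close>
      using W_inner_eq_0[OF rW, of h] by (cases "?I r r = 0") (auto simp: s_def)
    finally show ?thesis using True by simp
  qed
  then show ?case using eq by metis
qed

subsection \<open>The representer theorem\<close>

text \<open>Formulated for an abstract \<open>T\<close> and a flat index; the block structure of the
  data is restored afterwards by regrouping the sum.\<close>

lemma minimal_norm_solution_in_span:
  assumes ab: "a < b"
    and riesz: "\<And>j. j \<in> {1..N} \<Longrightarrow> is_Riesz_representer a b (\<lambda>f. T f j) (e j)"
    and min: "is_minimal_norm_solution a b N T y f"
  shows "\<exists>w. \<forall>t\<in>{a..b}. f t = (\<Sum>j=1..N. w j * e j t)"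
proof -
  let ?I = "W_inner a b"
  have e: "e j \<in> W a b" and T: "\<And>q. q \<in> W a b \<Longrightarrow> T q j = ?I (e j) q" if "j \<in> {1..N}" for j
    using riesz[OF that] by (auto simp: is_Riesz_representer_def)
  have lsf: "is_least_squares_solution a b N T y f"
    and minf: "\<And>q. is_least_squares_solution a b N T y q \<Longrightarrow> W_norm a b f \<le> W_norm a b q"
    using min by (auto simp: is_minimal_norm_solution_def is_arg_min_def not_less)
  have f: "f \<in> W a b" using lsf by (simp add: is_least_squares_solution_def is_arg_min_def)
  obtain w where w: "\<And>i. i \<in> {1..N} \<Longrightarrow>
      ?I (\<lambda>t. f t + (-1) * (\<Sum>j=1..N. w j * e j t)) (e i) = 0"
    using W_projection_exists[where e = e and N = N, OF ab e f] by blast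
  define p where "p = (\<lambda>t. \<Sum>j=1..N. w j * e j t)"
  define h where "h = (\<lambda>t. f t + (-1) * p t)"
  have pW: "p \<in> W a b" unfolding p_def by (rule W_sum[OF ab e])
  have hW: "h \<in> W a b" unfolding h_def by (rule W_lincomb[OF ab f pW])
  have he: "?I h (e i) = 0" if "i \<in> {1..N}" for i using w[OF that] by (simp add: h_def p_def)
  have hp: "?I h p = 0"
    unfolding p_def using W_inner_sum_right[OF ab hW e] he by simp
  \<comment> \<open>The difference \<open>T f j - T p j\<close> is the inner product of
    \<open>e j\<close> with \<open>h\<close>, which is zero.\<close>
  have "T p j = T f j" if j: "j \<in> {1..N}" for j
    using W_inner_lincomb_right[OF ab f pW e[OF j], of "-1"] he[OF j] T[OF j pW] T[OF j f]
    by (simp add: h_def W_inner_commute[of a b "e j"])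
  then have "L2_set (\<lambda>j. T p j - y j) {1..N} = L2_set (\<lambda>j. T f j - y j) {1..N}"
    by (intro L2_set_cong) auto
  then have "is_least_squares_solution a b N T y p"
    using lsf pW by (simp add: is_least_squares_solution_def is_arg_min_def)
  from minf[OF this] have le: "?I f f \<le> ?I p p" by (simp add: W_norm_def W_inner_self)
  have fh: "f = (\<lambda>t. h t + 1 * p t)" by (simp add: h_def)
  \<comment> \<open>Expanding both arguments of \<open>?I f f\<close> and dropping the mixed terms
    gives Pythagoras; with \<open>le\<close> this leaves no room for \<open>?I h h\<close>.\<close>
  have "?I f f = ?I h f + ?I p f"
    using W_inner_lincomb_left[OF ab hW pW f, of 1] fh by simp
  also have "\<dots> = ?I h h + ?I p p"
    using W_inner_lincomb_right[OF ab hW pW hW, of 1] W_inner_lincomb_right[OF ab hW pW pW, of 1]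
      fh hp W_inner_commute[of a b p h] by simp
  finally have "?I h h \<le> 0" using le by simp
  moreover have "?I h h \<ge> 0" by (simp add: W_inner_self)
  ultimately have "?I h h = 0" by simp
  from W_inner_self_eq_0_imp[OF ab hW this] have "\<forall>t\<in>{a..b}. f t = p t" by (simp add: h_def)
  then show ?thesis unfolding p_def by blast
qed

text \<open>Indices start at 1, so block \<open>l\<close> occupies the \<open>n l\<close> places
  directly after \<open>offset n (l - 1)\<close>; each induction step splits off the last block and
  shifts it.\<close>

lemma sum_offset_blocks:
  fixes F :: "nat \<Rightarrow> real"
  shows "(\<Sum>j=1..offset n m. F j) = (\<Sum>l=1..m. \<Sum>i=1..n l. F (i + offset n (l - 1)))"
proof (induction m)
  case 0
  then show ?case by (simp add: offset_def)
next
  case (Suc m)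
  have off: "offset n (Suc m) = offset n m + n (Suc m)" by (simp add: offset_def)
  have "sum F {1..offset n m + n (Suc m)}
      = sum F {1..offset n m} + sum F {offset n m + 1..offset n m + n (Suc m)}"
    by (rule sum.ub_add_nat) simp
  also have "sum F {offset n m + 1..offset n m + n (Suc m)} = (\<Sum>i=1..n (Suc m). F (i + offset n m))"
    using sum.shift_bounds_cl_nat_ivl[of F 1 "offset n m" "n (Suc m)"] by (simp add: add.commute)
  finally show ?case using Suc off by simp
qed

theorem theorem3p1:
  fixes a b :: real
    and m :: nat and n :: "nat \<Rightarrow> nat"
    and c d :: "nat \<Rightarrow> real"
    and k :: "nat \<Rightarrow> real \<Rightarrow> real \<Rightarrow> real"
    and x :: "nat \<Rightarrow> nat \<Rightarrow> real"
    and g :: "nat \<Rightarrow> real \<Rightarrow> real"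
    and \<eta> :: "nat \<Rightarrow> real \<Rightarrow> real"
    and f_dag :: "real \<Rightarrow> real"
  assumes "a < b"
    and "m \<ge> 1"
    and "\<And>l. l \<in> {1..m} \<Longrightarrow> n l \<ge> 1"
    and "\<And>l i. l \<in> {1..m} \<Longrightarrow> i \<in> {1..n l} \<Longrightarrow> x l i \<in> {c l..d l}"
    and "\<And>l i f. l \<in> {1..m} \<Longrightarrow> i \<in> {1..n l} \<Longrightarrow> f \<in> W a b \<Longrightarrow>
           integrable (lebesgue_on {a..b}) (\<lambda>t. k l (x l i) t * f t)"
    and "bounded_linear_on_W a b (offset n m) (discrete_op a b n k x)"
    and "\<And>j. j \<in> {1..offset n m} \<Longrightarrow>
           is_Riesz_representer a b (\<lambda>f. discrete_op a b n k x f j) (\<eta> j)"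
    and "is_minimal_norm_solution a b (offset n m) (discrete_op a b n k x)
           (data_vector n x g) f_dag"
  shows "\<exists>coef :: nat \<Rightarrow> real. \<forall>t\<in>{a..b}.
           f_dag t = (\<Sum>l=1..m. \<Sum>i=1..n l.
             coef (i + offset n (l - 1)) * \<eta> (i + offset n (l - 1)) t)"
proof -
  obtain w where "\<forall>t\<in>{a..b}. f_dag t = (\<Sum>j=1..offset n m. w j * \<eta> j t)"
    using minimal_norm_solution_in_span[OF assms(1) assms(7,8)] by blast
  then show ?thesis
    by (intro exI[of _ w]) (simp only: sum_offset_blocks)
qed

end
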